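(* Let $m,k\ge1$ be integers. Let $z_1,\dots,z_T\in\mathbb{R}_{\ge0}^m$ be any finite exact-budget fractional path, i.e. $\sum_{i=1}^m z_{t,i}=k$ for every $t$, and let $y_0\in X_{m,k}$ be any integral state. Then the repair rule (described in the context), started from $y_0$ and applied successively to $z_1,\dots,z_T$, produces a deterministic prefix-causal integral path $y_1,\dots,y_T\in X_{m,k}$ satisfying \[ 1+z_{t,i}\le 3(1+y_{t,i})\quad\text{for every } t\in\{1,\dots,T\},\ i\in\{1,\dots,m\}, \] \[ \sum_{t=1}^T\lVert y_t-y_{t-1}\rVert_1\le 6k+\sum_{t=2}^T\lVert z_t-z_{t-1}\rVert_1 . \] Consequently, for every sequence of nonnegative workload vectors $r_1,\dots,r_T\in\mathbb{R}_{\ge0}^m$, with $f_t(x)=\max_{1\le i\le m}\frac{r_{t,i}}{1+x_i}$ for $x\in\mathbb{R}_{\ge0}^m$, \[ \sum_{t=1}^T f_t(y_t)\le 3\sum_{t=1}^T f_t(z_t). \]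
   Context: $X_{m,k}=\{x\in\mathbb{Z}_{\ge0}^m:\sum_{i=1}^m x_i=k\}$, and $e_i$ denotes the $i$-th standard basis vector. For $z\in\mathbb{R}_{\ge0}^m$ with $\sum_i z_i=k$, the required integral level is \[ \ell_i(z)=\max\left\{0,\left\lceil\frac{z_i-2}{3}\right\rceil\right\}. \] **Repair rule.** Given a previous integral state $y\in X_{m,k}$ and the current fractional state $z$: while some coordinate has $y_i<\ell_i(z)$, choose the least such index $i$ and set $w:=y+e_i$ (a state of mass $k+1$). Among the positive coordinates of $w$ choose, using a fixed tie-breaking rule, a coordinate $j$ maximizing $d_j(w,z)=3w_j-1-z_j$. Set $y:=w-e_j$ and repeat. Stop when $y_i\ge\ell_i(z)$ for every $i$. For $t=1,\dots,T$, $y_t$ is the state obtained when this rule is applied to the previous state $y_{t-1}$ and the fractional state $z_t$. Prefix-causal means that $y_t$ depends only on $y_0$ and $z_1,\dots,z_t$. *)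

theory Defs
  imports "HOL-Analysis.Analysis" "HOL-Library.While_Combinator"
begin

(* Coordinates are indexed by a type 'm of class finite and linorder, so that m = CARD('m) \<ge> 1;
   the order on 'm is what gives meaning to the least deficient index. *)

type_synonym 'm nvec = "(nat, 'm) vec"
type_synonym 'm rvec = "(real, 'm) vec"

definition integral_states :: "nat \<Rightarrow> 'm::finite nvec set" where
  "integral_states k = {x. (\<Sum>i\<in>UNIV. x $ i) = k}"

definition fractional_states :: "nat \<Rightarrow> 'm::finite rvec set" where
  "fractional_states k = {z. (\<forall>i. 0 \<le> z $ i) \<and> (\<Sum>i\<in>UNIV. z $ i) = real k}"

definition real_vec :: "'m nvec \<Rightarrow> 'm::finite rvec" where
  "real_vec x = (\<chi> i. real (x $ i))"

definition l1_norm :: "'m::finite rvec \<Rightarrow> real" where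
  "l1_norm x = (\<Sum>i\<in>UNIV. \<bar>x $ i\<bar>)"

definition level :: "'m::finite rvec \<Rightarrow> 'm \<Rightarrow> int" where
  "level z i = max 0 \<lceil>(z $ i - 2) / 3\<rceil>"

definition deficient :: "'m::finite rvec \<Rightarrow> 'm nvec \<Rightarrow> 'm set" where
  "deficient z y = {i. int (y $ i) < level z i}"

definition excess :: "'m nvec \<Rightarrow> 'm::finite rvec \<Rightarrow> 'm \<Rightarrow> real" where
  "excess w z j = 3 * real (w $ j) - 1 - z $ j"

definition donors :: "'m nvec \<Rightarrow> 'm::finite rvec \<Rightarrow> 'm set" where
  "donors w z = {j. is_arg_max (excess w z) (\<lambda>j. w $ j > 0) j}"

(* A tie-breaking rule is any function selecting one of the maximizers;
   it may use w and z. Taking the least maximizer is one example. *)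
definition tie_breaking_rule :: "('m nvec \<Rightarrow> 'm::finite rvec \<Rightarrow> 'm) \<Rightarrow> bool" where
  "tie_breaking_rule tb \<longleftrightarrow> (\<forall>w z. donors w z \<noteq> {} \<longrightarrow> tb w z \<in> donors w z)"

(* The subtraction on nat is not truncated: w is nonzero, so donors w z is nonempty,
   and a tie-breaking rule selects a positive coordinate of w. *)
definition repair_step ::
    "('m::{finite,linorder} nvec \<Rightarrow> 'm rvec \<Rightarrow> 'm) \<Rightarrow> 'm rvec \<Rightarrow> 'm nvec \<Rightarrow> 'm nvec" where
  "repair_step tb z y =
     (let w = y + axis (Min (deficient z y)) 1 in w - axis (tb w z) 1)"

(* The result is None if the loop does not terminate. *)
definition repair ::
    "('m::{finite,linorder} nvec \<Rightarrow> 'm rvec \<Rightarrow> 'm) \<Rightarrow> 'm rvec \<Rightarrow> 'm nvec \<Rightarrow> 'm nvec option" where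
  "repair tb z y = while_option (\<lambda>y. deficient z y \<noteq> {}) (repair_step tb z) y"

(* z 0 is never used: a fractional path is z 1, ..., z T. *)
primrec repair_path ::
    "('m::{finite,linorder} nvec \<Rightarrow> 'm rvec \<Rightarrow> 'm) \<Rightarrow> 'm nvec \<Rightarrow> (nat \<Rightarrow> 'm rvec) \<Rightarrow>
     nat \<Rightarrow> 'm nvec option" where
  "repair_path tb y0 z 0 = Some y0"
| "repair_path tb y0 z (Suc t) = Option.bind (repair_path tb y0 z t) (repair tb (z (Suc t)))"

definition prefix_causal :: "nat \<Rightarrow> ('y \<Rightarrow> (nat \<Rightarrow> 'z) \<Rightarrow> nat \<Rightarrow> 'o) \<Rightarrow> bool" where
  "prefix_causal T out \<longleftrightarrow>
     (\<forall>y0 z z'. \<forall>t\<in>{1..T}. (\<forall>s\<in>{1..t}. z s = z' s) \<longrightarrow> out y0 z t = out y0 z' t)"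

definition workload_cost :: "'m::finite rvec \<Rightarrow> 'm rvec \<Rightarrow> real" where
  "workload_cost r x = (MAX i. r $ i / (1 + x $ i))"

end

theory Submission
  imports Defs
begin

text \<open>
  The potential \<open>\<Phi>(y, z) = \<parallel>z - 3y\<parallel>\<^sub>1\<close> drops by at least 2 in every repair step, which is also
  the cost of the step. At the receiver \<open>i\<close>, deficiency means \<open>z\<^sub>i - 3y\<^sub>i > 2\<close>, so its term drops by
  more than 1. If every positive coordinate of \<open>w\<close> had \<open>3w\<^sub>j - 1 - z\<^sub>j \<le> 1\<close>, then summing over the at
  most \<open>k + 1\<close> of them would give \<open>3(k + 1) - k \<le> 2(k + 1)\<close>; hence the donor has \<open>3w\<^sub>j - z\<^sub>j > 2\<close> and its
  term drops by more than 1 as well. As \<open>\<Phi>\<close> is 1-Lipschitz in \<open>z\<close> and \<open>\<Phi>(y\<^sub>0, z\<^sub>1) \<le> 4k\<close>, the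
  movement bound telescopes.
\<close>

definition potential :: "'m::finite nvec \<Rightarrow> 'm rvec \<Rightarrow> real" where
  "potential y z = l1_norm (z - 3 *\<^sub>R real_vec y)"

lemma l1_norm_nonneg: "0 \<le> l1_norm x"
  by (simp add: l1_norm_def sum_nonneg)

lemma l1_norm_triangle: "l1_norm (x + y) \<le> l1_norm x + l1_norm y"
  unfolding l1_norm_def by (simp add: sum.distrib[symmetric] sum_mono abs_triangle_ineq)

lemma potential_lipschitz: "potential y z' \<le> potential y z + l1_norm (z' - z)"
proof -
  have "z' - 3 *\<^sub>R real_vec y = (z - 3 *\<^sub>R real_vec y) + (z' - z)" by simp
  then show ?thesis unfolding potential_def by (metis l1_norm_triangle)
qed

text \<open>Both \<open>z\<close> and \<open>3y\<close> are nonnegative, so each term is at most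
  their sum, and the masses add up to k + 3k. This pays for the arbitrary initial state.\<close>

lemma potential_le:
  assumes "y \<in> integral_states k" "z \<in> fractional_states k"
  shows "potential y z \<le> 4 * real k"
proof -
  have "potential y z \<le> (\<Sum>i\<in>UNIV. z $ i + 3 * real (y $ i))"
    unfolding potential_def l1_norm_def
  proof (rule sum_mono)
    fix i
    have "0 \<le> z $ i" using assms(2) by (simp add: fractional_states_def)
    then show "\<bar>(z - 3 *\<^sub>R real_vec y) $ i\<bar> \<le> z $ i + 3 * real (y $ i)"
      by (simp add: real_vec_def)
  qed
  also have "\<dots> = real k + 3 * real (\<Sum>i\<in>UNIV. y $ i)"
    using assms(2) by (simp add: sum.distrib sum_distrib_left fractional_states_def)
  also have "\<dots> = 4 * real k" using assms(1) by (simp add: integral_states_def)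
  finally show ?thesis .
qed

lemma sum_split_two:
  fixes f :: "'m::finite \<Rightarrow> 'a::comm_monoid_add"
  assumes "i \<noteq> j"
  shows "sum f UNIV = f i + (f j + sum f (UNIV - {i, j}))"
proof -
  have "UNIV - {i} - {j} = UNIV - {i, j}" by blast
  then show ?thesis
    using assms sum.remove[of UNIV i f] sum.remove[of "UNIV - {i}" j f] by simp
qed

text \<open>The maximum with 0 drops out because \<open>y $ i\<close> is a natural number, and an
  integer lies below a ceiling exactly when it lies strictly below the argument. The strict bound 2
  is what later makes the receiver's term drop.\<close>

lemma deficient_iff: "i \<in> deficient z y \<longleftrightarrow> 3 * real (y $ i) + 2 < z $ i"
proof -
  have "i \<in> deficient z y \<longleftrightarrow> int (y $ i) < \<lceil>(z $ i - 2) / 3\<rceil>"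
    by (simp add: deficient_def level_def less_max_iff_disj)
  also have "\<dots> \<longleftrightarrow> real (y $ i) < (z $ i - 2) / 3"
    by (simp only: less_ceiling_iff of_int_of_nat_eq)
  finally show ?thesis by (simp add: field_simps)
qed

lemma donor_excess:
  assumes w: "(\<Sum>i\<in>UNIV. w $ i) = Suc k" and z: "z \<in> fractional_states k"
    and tb: "tie_breaking_rule tb"
  shows "w $ (tb w z) > 0" and "excess w z (tb w z) > 1"
proof -
  let ?P = "{j. w $ j > 0}"
  have nz: "\<forall>i. 0 \<le> z $ i" and zk: "(\<Sum>i\<in>UNIV. z $ i) = real k"
    using z by (auto simp: fractional_states_def)
  have w': "(\<Sum>i\<in>?P. w $ i) = Suc k"
    unfolding w[symmetric] by (intro sum.mono_neutral_left) auto
  have "card ?P = (\<Sum>i\<in>?P. 1)" by simp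
  also have "\<dots> \<le> (\<Sum>i\<in>?P. w $ i)" by (intro sum_mono) auto
  finally have card: "card ?P \<le> Suc k" using w' by simp
  have zP: "(\<Sum>i\<in>?P. z $ i) \<le> real k"
    using sum_mono2[of UNIV ?P "\<lambda>i. z $ i"] nz zk by simp
  \<comment> \<open>Averaging over the support of \<open>w\<close>: the total excess is at least
    3(k+1) - (k+1) - k = k + 2, which exceeds the number of positive coordinates.\<close>
  have "\<exists>j\<in>?P. excess w z j > 1"
  proof (rule ccontr)
    assume "\<not> ?thesis"
    then have "\<forall>j\<in>?P. excess w z j \<le> 1" by (meson not_less)
    then have "(\<Sum>j\<in>?P. excess w z j) \<le> (\<Sum>j\<in>?P. 1)" by (intro sum_mono) (rule bspec)
    moreover have "(\<Sum>j\<in>?P. excess w z j) = 3 * real (\<Sum>j\<in>?P. w $ j) - card ?P - (\<Sum>j\<in>?P. z $ j)"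
      by (simp add: excess_def sum_subtractf sum_distrib_left)
    ultimately show False using w' zP card by simp
  qed
  then obtain j where j: "w $ j > 0" "excess w z j > 1" by auto
  \<comment> \<open>A tie-breaking rule is constrained only where \<open>donors\<close> is nonempty,
    so a maximizer is exhibited first. The coordinate picked by \<open>tb\<close> then has excess at
    least that of \<open>j\<close>.\<close>
  define m where "m = Max (excess w z ` ?P)"
  have "m \<in> excess w z ` ?P" unfolding m_def using j by (intro Max_in) auto
  then obtain a where a: "w $ a > 0" "excess w z a = m" by auto
  have "\<And>b. w $ b > 0 \<Longrightarrow> excess w z b \<le> m" unfolding m_def by (intro Max_ge) auto
  then have "a \<in> donors w z" using a by (auto simp: donors_def is_arg_max_def not_less)
  then have "tb w z \<in> donors w z" using tb by (auto simp: tie_breaking_rule_def)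
  then have "w $ (tb w z) > 0 \<and> excess w z j \<le> excess w z (tb w z)"
    using j(1) unfolding donors_def is_arg_max_def by (simp add: not_less) (metis less_nat_zero_code)
  then show "w $ (tb w z) > 0" and "excess w z (tb w z) > 1"
    using j(2) by simp_all
qed

lemma repair_step_decrease:
  fixes z :: "'m::{finite,linorder} rvec"
  assumes y: "y \<in> integral_states k" and z: "z \<in> fractional_states k"
    and tb: "tie_breaking_rule tb" and def: "deficient z y \<noteq> {}"
  defines "y' \<equiv> repair_step tb z y"
  shows "y' \<in> integral_states k"
    and "l1_norm (real_vec y' - real_vec y) = 2"
    and "potential y' z + 2 \<le> potential y z"
proof -
  define i where "i = Min (deficient z y)"
  define w where "w = y + axis i 1"
  define j where "j = tb w z"
  have "i \<in> deficient z y" unfolding i_def using def by (intro Min_in) auto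
  then have i: "3 * real (y $ i) + 2 < z $ i" by (simp add: deficient_iff)
  have w_nth: "w $ l = y $ l + (if l = i then 1 else 0)" for l
    by (auto simp: w_def axis_def)
  have "(\<Sum>l\<in>UNIV. w $ l) = Suc k"
    using y by (simp add: w_nth sum.distrib integral_states_def)
  note donor = donor_excess[OF this z tb, folded j_def]
  \<comment> \<open>At the receiver the excess is 3(y_i + 1) - 1 - z_i = 3y_i + 2 - z_i < 0, so the
    unit just added is not taken back.\<close>
  have ij: "i \<noteq> j"
    using donor(2) i by (auto simp: excess_def w_nth)
  have j: "y $ j > 0" "3 * real (y $ j) - z $ j > 2"
    using donor ij by (auto simp: excess_def w_nth)
  have y'_nth: "y' $ l = (if l = i then y $ i + 1 else if l = j then y $ j - 1 else y $ l)" for l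
    using ij unfolding y'_def repair_step_def Let_def i_def[symmetric] w_def[symmetric]
      j_def[symmetric] by (auto simp: w_nth axis_def)
  note split = sum_split_two[OF ij]
  \<comment> \<open>Kept general in \<open>g\<close> and its value type so that it serves the mass,
    the l1 distance and the potential alike.\<close>
  have rest: "(\<Sum>l\<in>UNIV - {i, j}. g l (y' $ l)) = (\<Sum>l\<in>UNIV - {i, j}. g l (y $ l))"
    for g :: "'m \<Rightarrow> nat \<Rightarrow> 'b::comm_monoid_add"
    by (intro sum.cong) (auto simp: y'_nth)
  have "(\<Sum>l\<in>UNIV. y' $ l) = (\<Sum>l\<in>UNIV. y $ l)"
    using ij j rest[of "\<lambda>l n. n"] unfolding split[of "\<lambda>l. y' $ l"] split[of "\<lambda>l. y $ l"]
    by (simp add: y'_nth)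
  then show "y' \<in> integral_states k" using y by (simp add: integral_states_def)
  show "l1_norm (real_vec y' - real_vec y) = 2"
    unfolding l1_norm_def split
    using ij j rest[of "\<lambda>l n. \<bar>real n - real (y $ l)\<bar>"]
    by (simp add: real_vec_def y'_nth of_nat_diff)
  have "y' $ i = y $ i + 1" "real (y' $ j) = real (y $ j) - 1"
    using ij j(1) by (simp_all add: y'_nth of_nat_diff)
  \<comment> \<open>Both are the fact that |a - 3| + 1 \<le> |a| for a > 2, with a = z_i - 3y_i at
    the receiver and a = 3y_j - z_j at the donor.\<close>
  then have "\<bar>z $ i - 3 * real (y' $ i)\<bar> + 1 \<le> \<bar>z $ i - 3 * real (y $ i)\<bar>"
    and "\<bar>z $ j - 3 * real (y' $ j)\<bar> + 1 \<le> \<bar>z $ j - 3 * real (y $ j)\<bar>"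
    using i j(2) by linarith+
  then show "potential y' z + 2 \<le> potential y z"
    unfolding potential_def l1_norm_def split
    using rest[of "\<lambda>l n. \<bar>z $ l - 3 * real n\<bar>"] by (simp add: real_vec_def)
qed

text \<open>The potential is nonnegative and falls by at least 2 per iteration, so its integer part
  is a termination measure in the naturals.\<close>

lemma repair_terminates:
  fixes z :: "'m::{finite,linorder} rvec"
  assumes y: "y \<in> integral_states k" and z: "z \<in> fractional_states k"
    and tb: "tie_breaking_rule tb"
  shows "\<exists>y'. repair tb z y = Some y'"
  unfolding repair_def
proof (rule measure_while_option_Some[where P = "\<lambda>y. y \<in> integral_states k"
      and f = "\<lambda>y. nat \<lfloor>potential y z\<rfloor>"])
  fix s assume s: "s \<in> integral_states k" "deficient z s \<noteq> {}"
  have "potential (repair_step tb z s) z + 2 \<le> potential s z"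
    by (rule repair_step_decrease(3)[OF s(1) z tb s(2)])
  moreover have "0 \<le> potential (repair_step tb z s) z"
    by (simp add: potential_def l1_norm_nonneg)
  ultimately have "nat \<lfloor>potential (repair_step tb z s) z\<rfloor> < nat \<lfloor>potential s z\<rfloor>"
    by linarith
  then show "repair_step tb z s \<in> integral_states k \<and>
      nat \<lfloor>potential (repair_step tb z s) z\<rfloor> < nat \<lfloor>potential s z\<rfloor>"
    using repair_step_decrease(1)[OF s(1) z tb s(2)] by blast
qed (rule y)

lemma repair_correct:
  fixes z :: "'m::{finite,linorder} rvec"
  assumes y: "y \<in> integral_states k" and z: "z \<in> fractional_states k"
    and tb: "tie_breaking_rule tb" and y': "repair tb z y = Some y'"
  shows "y' \<in> integral_states k"
    and "1 + z $ i \<le> 3 * (1 + real (y' $ i))"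
    and "l1_norm (real_vec y' - real_vec y) + potential y' z \<le> potential y z"
proof -
  \<comment> \<open>Loop invariant: net displacement from the initial state plus current potential
    never exceeds the initial potential. By the triangle inequality each iteration adds at most 2 to
    the displacement, which the potential drop covers.\<close>
  let ?I = "\<lambda>s. s \<in> integral_states k \<and>
    l1_norm (real_vec s - real_vec y) + potential s z \<le> potential y z"
  have "?I y'"
  proof (rule while_option_rule[OF _ y'[unfolded repair_def], where P = ?I])
    fix s assume s: "?I s" and d: "deficient z s \<noteq> {}"
    let ?s = "repair_step tb z s"
    note step = repair_step_decrease[OF conjunct1[OF s] z tb d]
    have "real_vec ?s - real_vec y = (real_vec ?s - real_vec s) + (real_vec s - real_vec y)"
      by simp
    then have "l1_norm (real_vec ?s - real_vec y) \<le> 2 + l1_norm (real_vec s - real_vec y)"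
      by (metis l1_norm_triangle step(2))
    then show "?I ?s" using step s by linarith
  qed (use y in \<open>simp add: l1_norm_def\<close>)
  then show "y' \<in> integral_states k"
    and "l1_norm (real_vec y' - real_vec y) + potential y' z \<le> potential y z" by auto
  have "deficient z y' = {}"
    using while_option_stop[OF y'[unfolded repair_def]] by simp
  then have "\<not> 3 * real (y' $ i) + 2 < z $ i" by (simp flip: deficient_iff)
  then show "1 + z $ i \<le> 3 * (1 + real (y' $ i))" by simp
qed

lemma repair_path_prefix:
  "(\<And>s. s \<in> {1..t} \<Longrightarrow> z s = z' s) \<Longrightarrow> repair_path tb y0 z t = repair_path tb y0 z' t"
  by (induction t) auto

text \<open>The coordinatewise comparison of denominators bounds each ratio by \<open>c\<close>
  times the corresponding ratio at \<open>z\<close>, and this passes to the maximum.\<close>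

lemma workload_cost_le:
  assumes "\<And>i. 0 \<le> r $ i" "\<And>i. 0 \<le> z $ i" "\<And>i. 0 \<le> x $ i"
    and le: "\<And>i. 1 + z $ i \<le> c * (1 + x $ i)" and "0 \<le> c"
  shows "workload_cost r x \<le> c * workload_cost r z"
proof -
  have "r $ i / (1 + x $ i) \<le> c * workload_cost r z" for i
  proof -
    have pos: "0 < 1 + x $ i" "0 < 1 + z $ i" using assms(2,3)[of i] by auto
    have "r $ i * (1 + z $ i) \<le> r $ i * (c * (1 + x $ i))"
      by (rule mult_left_mono[OF le assms(1)])
    then have "r $ i / (1 + x $ i) \<le> c * (r $ i / (1 + z $ i))"
      using pos by (simp add: field_simps)
    also have "\<dots> \<le> c * workload_cost r z"
      unfolding workload_cost_def using \<open>0 \<le> c\<close> by (intro mult_left_mono Max_ge) auto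
    finally show ?thesis .
  qed
  then show ?thesis by (subst workload_cost_def) simp
qed

theorem theorem8:
  fixes tb :: "'m::{finite,linorder} nvec \<Rightarrow> 'm rvec \<Rightarrow> 'm"
    and k T :: nat
    and z :: "nat \<Rightarrow> 'm rvec"
    and y0 :: "'m nvec"
  assumes "tie_breaking_rule tb"
    and "k \<ge> 1"
    and "\<forall>t\<in>{1..T}. z t \<in> fractional_states k"
    and "y0 \<in> integral_states k"
  shows "prefix_causal T (repair_path tb) \<and>
    (\<exists>y :: nat \<Rightarrow> 'm nvec.
      y 0 = y0 \<and>
      (\<forall>t\<in>{1..T}. repair_path tb y0 z t = Some (y t)) \<and>
      (\<forall>t\<in>{1..T}. y t \<in> integral_states k) \<and>
      (\<forall>t\<in>{1..T}. \<forall>i. 1 + z t $ i \<le> 3 * (1 + real (y t $ i))) \<and>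
      (\<Sum>t=1..T. l1_norm (real_vec (y t) - real_vec (y (t - 1))))
        \<le> 6 * real k + (\<Sum>t=2..T. l1_norm (z t - z (t - 1))) \<and>
      (\<forall>r :: nat \<Rightarrow> 'm rvec. (\<forall>t\<in>{1..T}. \<forall>i. 0 \<le> r t $ i) \<longrightarrow>
        (\<Sum>t=1..T. workload_cost (r t) (real_vec (y t)))
          \<le> 3 * (\<Sum>t=1..T. workload_cost (r t) (z t))))"
proof -
  note tb = assms(1) and y0 = assms(4)
  have z: "z t \<in> fractional_states k" if "t \<in> {1..T}" for t
    using assms(3) that by blast
  \<comment> \<open>For t beyond \<open>T\<close> the value may be an unspecified
    \<open>the None\<close>; only t \<le> T is ever claimed. Termination and mass k are proved
    together, since each repair needs the mass of the preceding state.\<close>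
  define y where "y t = the (repair_path tb y0 z t)" for t
  have path: "repair_path tb y0 z t = Some (y t) \<and> y t \<in> integral_states k" if "t \<le> T" for t
    using that
  proof (induction t)
    case 0
    then show ?case using y0 by (simp add: y_def)
  next
    case (Suc t)
    then have IH: "repair_path tb y0 z t = Some (y t)" "y t \<in> integral_states k"
      and zt: "z (Suc t) \<in> fractional_states k"
      using z by auto
    obtain y' where y': "repair tb (z (Suc t)) (y t) = Some y'"
      using repair_terminates[OF IH(2) zt tb] by blast
    then have "repair_path tb y0 z (Suc t) = Some y'" using IH(1) by simp
    moreover from this have "y (Suc t) = y'" by (simp only: y_def option.sel)
    ultimately show ?case using repair_correct(1)[OF IH(2) zt tb y'] by simp
  qed
  have step: "repair tb (z (Suc t)) (y t) = Some (y (Suc t))" if "Suc t \<le> T" for t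
    using path[of t] path[OF that] that by simp
  note correct = repair_correct[OF conjunct2[OF path] z tb step]
  have feasible: "1 + z t $ i \<le> 3 * (1 + real (y t $ i))" if "t \<in> {1..T}" for t i
    using that correct(2)[of "t - 1" i] by (cases t) simp_all
  \<comment> \<open>The current potential stays on the left so that the induction telescopes. It
    starts at time 1, the first time with a fractional state, where the initial potential
    contributes 4k.\<close>
  have move: "(\<Sum>s=1..Suc n. l1_norm (real_vec (y s) - real_vec (y (s - 1)))) + potential (y (Suc n)) (z (Suc n))
      \<le> 4 * real k + (\<Sum>s=2..Suc n. l1_norm (z s - z (s - 1)))" if "Suc n \<le> T" for n
    using that
  proof (induction n)
    case 0
    then show ?case
      using correct(3)[of 0] potential_le[OF conjunct2[OF path] z, of 0 1] by simp
  next
    case (Suc n)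
    have "l1_norm (real_vec (y (Suc (Suc n))) - real_vec (y (Suc n)))
        + potential (y (Suc (Suc n))) (z (Suc (Suc n)))
        \<le> potential (y (Suc n)) (z (Suc (Suc n)))"
      using correct(3)[of "Suc n"] Suc.prems by simp
    \<comment> \<open>With the integral state held fixed, replacing the fractional state costs at
      most its own movement.\<close>
    also have "\<dots> \<le> potential (y (Suc n)) (z (Suc n)) + l1_norm (z (Suc (Suc n)) - z (Suc n))"
      by (rule potential_lipschitz)
    finally show ?case using Suc by simp
  qed
  have total: "(\<Sum>t=1..T. l1_norm (real_vec (y t) - real_vec (y (t - 1))))
      \<le> 6 * real k + (\<Sum>t=2..T. l1_norm (z t - z (t - 1)))"
  proof (cases T)
    case (Suc n)
    \<comment> \<open>Discarding the final potential leaves the constant 4k, which is within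
      6k.\<close>
    have "0 \<le> potential (y T) (z T)" by (simp add: potential_def l1_norm_nonneg)
    then show ?thesis using move[of n] Suc by simp
  qed simp
  have cost: "(\<Sum>t=1..T. workload_cost (r t) (real_vec (y t)))
      \<le> 3 * (\<Sum>t=1..T. workload_cost (r t) (z t))"
    if "\<forall>t\<in>{1..T}. \<forall>i. 0 \<le> r t $ i" for r :: "nat \<Rightarrow> 'm rvec"
    unfolding sum_distrib_left
    using that z feasible
    by (intro sum_mono workload_cost_le) (simp_all add: real_vec_def fractional_states_def)
  have "prefix_causal T (repair_path tb)"
    unfolding prefix_causal_def
    by (intro allI ballI impI repair_path_prefix) (rule bspec)
  moreover have "y 0 = y0" by (simp add: y_def)
  moreover have "\<forall>t\<in>{1..T}. repair_path tb y0 z t = Some (y t)"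
    and "\<forall>t\<in>{1..T}. y t \<in> integral_states k"
    using path by simp_all
  ultimately show ?thesis
    by (intro conjI exI[of _ y] ballI allI impI total) (use feasible cost in blast)+
qed

end
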